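(* Let $A_1,A_2\in\mathbb{R}^{m\times n}$ and let $A_1=U_1-V_1$ and $A_2=U_2-V_2$ be two proper weak regular splittings of different types (one of type I and the other of type II). Suppose that $\rho(U_1^{\dagger}V_1)>0$ and $\rho(U_2^{\dagger}V_2)>0$. Assume that $V_1\neq 0$, $V_2\neq 0$ and $A_2^{\dagger}>A_1^{\dagger}\geq 0$. If $V_1\leq V_2$, then $\rho(U_1^{\dagger}V_1)<\rho(U_2^{\dagger}V_2)<1$.
   Context: $A^{\dagger}$ denotes the Moore–Penrose inverse and $\rho(\cdot)$ the spectral radius. Inequalities between matrices are entrywise; $X>Y$ means every entry of $X-Y$ is positive. A splitting $A=U-V$ is proper if $R(U)=R(A)$ and $N(U)=N(A)$. A proper splitting is a proper weak regular splitting of type I if $U^{\dagger}\geq 0$ and $U^{\dagger}V\geq 0$, and of type II if $U^{\dagger}\geq 0$ and $VU^{\dagger}\geq 0$. *)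

theory Defs
  imports "HOL-Analysis.Analysis"
begin

text \<open>Real m x n matrices are rendered as real^'n^'m (rows indexed by 'm).\<close>

definition mp_inverse :: "real^'n^'m \<Rightarrow> real^'m^'n" where
  "mp_inverse A = (THE X. A ** X ** A = A \<and> X ** A ** X = X \<and>
      transpose (A ** X) = A ** X \<and> transpose (X ** A) = X ** A)"

definition mat_range :: "real^'n^'m \<Rightarrow> (real^'m) set" where
  "mat_range A = range (\<lambda>x. A *v x)"

definition mat_null :: "real^'n^'m \<Rightarrow> (real^'n) set" where
  "mat_null A = {x. A *v x = 0}"

text \<open>Entrywise orderings.\<close>
definition mat_nonneg :: "real^'n^'m \<Rightarrow> bool" where
  "mat_nonneg X \<longleftrightarrow> (\<forall>i j. X $ i $ j \<ge> 0)"

definition mat_le :: "real^'n^'m \<Rightarrow> real^'n^'m \<Rightarrow> bool" where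
  "mat_le X Y \<longleftrightarrow> (\<forall>i j. X $ i $ j \<le> Y $ i $ j)"

definition mat_gt :: "real^'n^'m \<Rightarrow> real^'n^'m \<Rightarrow> bool" where
  "mat_gt X Y \<longleftrightarrow> (\<forall>i j. X $ i $ j > Y $ i $ j)"

text \<open>Spectral radius: maximum modulus of the (complex) eigenvalues.\<close>
definition complex_eigenvalues :: "real^'n^'n \<Rightarrow> complex set" where
  "complex_eigenvalues M = {l. \<exists>v::complex^'n. v \<noteq> 0 \<and>
      (\<chi> i j. complex_of_real (M $ i $ j)) *v v = l *s v}"

definition spectral_radius :: "real^'n^'n \<Rightarrow> real" where
  "spectral_radius M = Max (cmod ` complex_eigenvalues M)"

definition proper_splitting :: "real^'n^'m \<Rightarrow> real^'n^'m \<Rightarrow> real^'n^'m \<Rightarrow> bool" where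
  "proper_splitting A U V \<longleftrightarrow> A = U - V \<and> mat_range U = mat_range A \<and> mat_null U = mat_null A"

definition pwr_splitting_I :: "real^'n^'m \<Rightarrow> real^'n^'m \<Rightarrow> real^'n^'m \<Rightarrow> bool" where
  "pwr_splitting_I A U V \<longleftrightarrow> proper_splitting A U V \<and>
     mat_nonneg (mp_inverse U) \<and> mat_nonneg (mp_inverse U ** V)"

definition pwr_splitting_II :: "real^'n^'m \<Rightarrow> real^'n^'m \<Rightarrow> real^'n^'m \<Rightarrow> bool" where
  "pwr_splitting_II A U V \<longleftrightarrow> proper_splitting A U V \<and>
     mat_nonneg (mp_inverse U) \<and> mat_nonneg (V ** mp_inverse U)"

end

theory Submission
  imports Defs "HOL-Computational_Algebra.Fundamental_Theorem_Algebra"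
begin

text \<open>For a type I splitting, a nonnegative left Perron vector \<open>y\<close> of \<open>U\<^sup>\<dagger>V\<close> gives
  \<open>p = y U\<^sup>\<dagger> \<ge> 0\<close> with \<open>p V = \<rho> y\<close>, and the identity \<open>A\<^sup>\<dagger> = U\<^sup>\<dagger> + U\<^sup>\<dagger>V A\<^sup>\<dagger>\<close>
  turns into \<open>p = (1 - \<rho>) y A\<^sup>\<dagger>\<close>, whence \<open>\<rho> < 1\<close>. Dually, a type II splitting gives
  \<open>q = U\<^sup>\<dagger>x \<ge> 0\<close> with \<open>V q = \<rho> x\<close> and \<open>q = (1 - \<rho>) A\<^sup>\<dagger>x\<close>; here \<open>x\<close> is a Perron
  vector of \<open>V U\<^sup>\<dagger>\<close>, which has the same (nonzero) spectral radius as \<open>U\<^sup>\<dagger>V\<close>.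
  Pairing the left vector of one splitting with the right vector of the other, \<open>V\<^sub>1 \<le> V\<^sub>2\<close>
  yields \<open>\<rho>\<^sub>1(1 - \<rho>\<^sub>2) y A\<^sub>2\<^sup>\<dagger> x \<le> \<rho>\<^sub>2(1 - \<rho>\<^sub>1) y A\<^sub>1\<^sup>\<dagger> x\<close>, and
  \<open>A\<^sub>2\<^sup>\<dagger> > A\<^sub>1\<^sup>\<dagger> \<ge> 0\<close> then forces \<open>\<rho>\<^sub>1 < \<rho>\<^sub>2\<close>.

  The Perron vectors come from a weak Perron theorem, proved by applying Brouwer's fixed
  point theorem to perturbed matrices; the Moore--Penrose inverse is shown to exist via
  orthogonal projections.\<close>

section \<open>Complex eigenvalues and the spectral radius\<close>

definition complex_of_matrix :: "real^'n^'m \<Rightarrow> complex^'n^'m" where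
  "complex_of_matrix M = (\<chi> i j. complex_of_real (M $ i $ j))"

lemma complex_eigenvalues_altdef:
  "complex_eigenvalues M = {l. \<exists>v. v \<noteq> 0 \<and> complex_of_matrix M *v v = l *s v}"
  unfolding complex_eigenvalues_def complex_of_matrix_def by simp

lemma complex_of_matrix_mult: "complex_of_matrix (A ** B) = complex_of_matrix A ** complex_of_matrix B"
  by (simp add: complex_of_matrix_def matrix_matrix_mult_def vec_eq_iff)

lemma complex_of_matrix_transpose: "complex_of_matrix (transpose M) = transpose (complex_of_matrix M)"
  by (simp add: complex_of_matrix_def transpose_def vec_eq_iff)

text \<open>The Leibniz expansion of \<open>det (mat X - C)\<close>.\<close>

definition char_poly :: "complex^'n^'n \<Rightarrow> complex poly" where
  "char_poly C = (\<Sum>p | p permutes (UNIV::'n set). smult (of_int (sign p))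
       (\<Prod>i\<in>UNIV. [: - C $ i $ p i, if p i = i then 1 else 0 :]))"

lemma poly_char_poly:
  fixes C :: "complex^'n^'n"
  shows "poly (char_poly C) z = det (mat z - C)"
  unfolding char_poly_def det_def poly_sum
proof (intro sum.cong refl)
  fix p :: "'n \<Rightarrow> 'n"
  show "poly (smult (of_int (sign p)) (\<Prod>i\<in>UNIV. [: - C $ i $ p i, if p i = i then 1 else 0 :])) z =
    of_int (sign p) * (\<Prod>i\<in>UNIV. (mat z - C) $ i $ p i)"
    unfolding poly_smult poly_prod
    by (intro arg_cong2[where f="(*)"] refl prod.cong) (simp_all add: mat_def eq_commute)
qed

lemma coeff_char_poly_card: "coeff (char_poly (C::complex^'n^'n)) CARD('n) = 1"
proof -
  let ?f = "\<lambda>p i. [: - C $ i $ p i, if p i = i then 1 else 0 :]"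
  let ?g = "\<lambda>p. of_int (sign p) * coeff (\<Prod>i\<in>UNIV. ?f p i) CARD('n)"
  have deficient: "coeff (\<Prod>i\<in>UNIV. ?f p i) CARD('n) = 0" if "p \<noteq> id" for p
  proof -
    obtain k where k: "p k \<noteq> k" using \<open>p \<noteq> id\<close> by (auto simp: fun_eq_iff)
    have "degree (\<Prod>i\<in>UNIV. ?f p i) \<le> (\<Sum>i\<in>UNIV. degree (?f p i))"
      using degree_prod_sum_le[of UNIV "?f p"] by (simp add: o_def)
    also have "\<dots> < (\<Sum>i\<in>(UNIV::'n set). 1)"
      by (rule sum_strict_mono_ex1) (use k in auto)
    finally show ?thesis by (simp add: coeff_eq_0)
  qed
  have "degree (\<Prod>i\<in>UNIV. ?f id i) = CARD('n)"
    using degree_prod_eq_sum_degree[of UNIV "?f id"] by simp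
  moreover have "lead_coeff (\<Prod>i\<in>UNIV. ?f id i) = 1"
    by (simp add: lead_coeff_prod)
  ultimately have "coeff (\<Prod>i\<in>UNIV. ?f id i) CARD('n) = 1"
    by simp
  moreover have "coeff (char_poly C) CARD('n) = ?g id + sum ?g ({p. p permutes UNIV} - {id})"
    unfolding char_poly_def coeff_sum
    by (simp add: sum.remove[of _ id] finite_permutations permutes_id)
  moreover have "sum ?g ({p. p permutes UNIV} - {id}) = 0"
    by (rule sum.neutral) (auto simp: deficient)
  ultimately show ?thesis by (simp add: sign_id)
qed

lemma char_poly_nonzero: "char_poly C \<noteq> 0"
  using coeff_char_poly_card[of C] by auto

lemma matrix_vector_mul_mat: "(mat l :: 'a::comm_ring_1^'n^'n) *v v = l *s v"
  by (simp add: vec_eq_iff matrix_vector_mult_def mat_def if_distrib if_distribR sum.delta'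
      cong: if_cong)

lemma eigenvector_exists_iff_det:
  "(\<exists>v. v \<noteq> 0 \<and> C *v v = l *s v) \<longleftrightarrow> det (mat l - C) = (0::complex)"
proof -
  have "(mat l - C) *v v = 0 \<longleftrightarrow> C *v v = l *s v" for v
  proof -
    have "(mat l - C) *v v = l *s v - C *v v"
      by (simp add: matrix_vector_mult_diff_rdistrib matrix_vector_mul_mat)
    then show ?thesis by (metis right_minus_eq)
  qed
  moreover have "det (mat l - C) \<noteq> 0 \<longleftrightarrow> (\<forall>v. (mat l - C) *v v = 0 \<longrightarrow> v = 0)"
    using det_nz_iff_inj_gen[of "(*v) (mat l - C)"] vec.linear_inj_iff_eq_0[of "(*v) (mat l - C)"]
    by simp
  ultimately show ?thesis by blast
qed

lemma complex_eigenvalues_eq_roots: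
  "complex_eigenvalues M = {l. poly (char_poly (complex_of_matrix M)) l = 0}"
  unfolding complex_eigenvalues_altdef poly_char_poly eigenvector_exists_iff_det ..

lemma finite_complex_eigenvalues: "finite (complex_eigenvalues M)"
  unfolding complex_eigenvalues_eq_roots by (rule poly_roots_finite[OF char_poly_nonzero])

lemma complex_eigenvalues_nonempty: "complex_eigenvalues (M::real^'n^'n) \<noteq> {}"
proof -
  let ?p = "char_poly (complex_of_matrix M)"
  have "CARD('n) \<le> degree ?p"
    by (rule le_degree) (simp add: coeff_char_poly_card)
  then have "degree ?p \<noteq> 0"
    using zero_less_card_finite[where 'a='n] by linarith
  then have "\<not> constant (poly ?p)"
    by (simp add: constant_degree)
  then obtain z where "poly ?p z = 0" using fundamental_theorem_of_algebra by blast
  then show ?thesis unfolding complex_eigenvalues_eq_roots by blast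
qed

lemma cmod_eigenvalue_le_spectral_radius:
  "l \<in> complex_eigenvalues M \<Longrightarrow> cmod l \<le> spectral_radius M"
  unfolding spectral_radius_def by (rule Max_ge) (auto simp: finite_complex_eigenvalues)

lemma spectral_radius_attained:
  obtains l where "l \<in> complex_eigenvalues (M::real^'n^'n)" "cmod l = spectral_radius M"
proof -
  have "spectral_radius M \<in> cmod ` complex_eigenvalues M"
    unfolding spectral_radius_def
    by (rule Max_in) (auto simp: finite_complex_eigenvalues complex_eigenvalues_nonempty)
  then show ?thesis using that by auto
qed

lemma transpose_diff: "transpose (A - B) = transpose A - (transpose B :: 'a::ring^'n^'m)"
  by (simp add: transpose_def vec_eq_iff)

lemma complex_eigenvalues_transpose:
  "complex_eigenvalues (transpose M) = complex_eigenvalues (M::real^'n^'n)"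
proof -
  have "mat l - complex_of_matrix (transpose M) = transpose (mat l - complex_of_matrix M)" for l
    by (simp add: complex_of_matrix_transpose transpose_diff)
  then show ?thesis
    unfolding complex_eigenvalues_altdef eigenvector_exists_iff_det by (simp add: det_transpose)
qed

lemma spectral_radius_transpose: "spectral_radius (transpose M) = spectral_radius (M::real^'n^'n)"
  unfolding spectral_radius_def complex_eigenvalues_transpose ..

lemma nonzero_eigenvalue_mult_commute:
  fixes A :: "real^'k^'n" and B :: "real^'n^'k"
  assumes "l \<in> complex_eigenvalues (A ** B)" "l \<noteq> 0"
  shows "l \<in> complex_eigenvalues (B ** A)"
proof -
  let ?A = "complex_of_matrix A" and ?B = "complex_of_matrix B"
  obtain v where v: "v \<noteq> 0" "(?A ** ?B) *v v = l *s v"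
    using assms(1) unfolding complex_eigenvalues_altdef complex_of_matrix_mult by blast
  let ?w = "?B *v v"
  have Aw: "?A *v ?w = l *s v" using v(2) by (simp add: matrix_vector_mul_assoc)
  then have "?w \<noteq> 0" using v(1) assms(2) by auto
  moreover have "(?B ** ?A) *v ?w = l *s ?w"
  proof -
    have "(?B ** ?A) *v ?w = ?B *v (?A *v ?w)"
      by (simp add: matrix_vector_mul_assoc matrix_mul_assoc)
    also have "\<dots> = ?B *v (l *s v)" using Aw by simp
    also have "\<dots> = l *s ?w"
      by (simp add: vec_eq_iff matrix_vector_mult_def sum_distrib_left algebra_simps)
    finally show ?thesis .
  qed
  ultimately show ?thesis unfolding complex_eigenvalues_altdef complex_of_matrix_mult by blast
qed

lemma spectral_radius_mult_commute:
  fixes A :: "real^'k^'n" and B :: "real^'n^'k"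
  assumes "spectral_radius (A ** B) > 0"
  shows "spectral_radius (B ** A) = spectral_radius (A ** B)"
proof -
  obtain l where l: "l \<in> complex_eigenvalues (A ** B)" "cmod l = spectral_radius (A ** B)"
    by (rule spectral_radius_attained)
  with assms have "l \<in> complex_eigenvalues (B ** A)"
    using nonzero_eigenvalue_mult_commute by force
  then have ge: "spectral_radius (A ** B) \<le> spectral_radius (B ** A)"
    using cmod_eigenvalue_le_spectral_radius l(2) by metis
  obtain k where k: "k \<in> complex_eigenvalues (B ** A)" "cmod k = spectral_radius (B ** A)"
    by (rule spectral_radius_attained)
  with assms ge have "k \<in> complex_eigenvalues (A ** B)"
    using nonzero_eigenvalue_mult_commute by force
  then have "spectral_radius (B ** A) \<le> spectral_radius (A ** B)"
    using cmod_eigenvalue_le_spectral_radius k(2) by metis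
  with ge show ?thesis by simp
qed

section \<open>A weak Perron theorem\<close>

definition vec_nonneg :: "real^'n \<Rightarrow> bool" where
  "vec_nonneg x \<longleftrightarrow> (\<forall>i. 0 \<le> x $ i)"

lemma vec_nonneg_matrix_vector_mult: "mat_nonneg M \<Longrightarrow> vec_nonneg x \<Longrightarrow> vec_nonneg (M *v x)"
  unfolding mat_nonneg_def vec_nonneg_def matrix_vector_mult_def by (auto intro!: sum_nonneg)

lemma vec_nonneg_vector_matrix_mult: "mat_nonneg M \<Longrightarrow> vec_nonneg y \<Longrightarrow> vec_nonneg (y v* M)"
  unfolding mat_nonneg_def vec_nonneg_def vector_matrix_mult_def by (auto intro!: sum_nonneg)

definition std_simplex :: "(real^'n) set" where
  "std_simplex = {x. vec_nonneg x \<and> (\<Sum>i\<in>UNIV. x $ i) = 1}"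

lemma std_simplex_nonzero: "x \<in> std_simplex \<Longrightarrow> x \<noteq> 0"
  by (auto simp: std_simplex_def)

lemma std_simplex_component_le_1:
  assumes "x \<in> std_simplex"
  shows "x $ i \<le> 1"
proof -
  have "x $ i \<le> (\<Sum>j\<in>UNIV. x $ j)"
    using assms by (intro member_le_sum) (auto simp: std_simplex_def vec_nonneg_def)
  then show ?thesis using assms by (simp add: std_simplex_def)
qed

lemma compact_std_simplex: "compact (std_simplex :: (real^'n) set)"
proof -
  have "std_simplex \<subseteq> cball (0::real^'n) 1"
  proof
    fix x :: "real^'n" assume x: "x \<in> std_simplex"
    have "norm x \<le> (\<Sum>i\<in>UNIV. \<bar>x $ i\<bar>)" by (rule norm_le_l1_cart)
    also have "\<dots> = 1" using x by (simp add: std_simplex_def vec_nonneg_def)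
    finally show "x \<in> cball 0 1" by simp
  qed
  then have "bounded (std_simplex :: (real^'n) set)"
    using bounded_cball bounded_subset by blast
  moreover have "closed (std_simplex :: (real^'n) set)"
  proof -
    have c: "continuous_on UNIV (\<lambda>x::real^'n. x $ i)" for i
      by (rule continuous_on_component[OF continuous_on_id])
    have "closed ({x::real^'n. \<forall>i. 0 \<le> x $ i} \<inter> {x. (\<Sum>i\<in>UNIV. x $ i) = 1})"
      by (intro closed_Int closed_Collect_all closed_Collect_le closed_Collect_eq
          continuous_on_const continuous_on_sum c)
    then show ?thesis by (simp add: std_simplex_def vec_nonneg_def Collect_conj_eq)
  qed
  ultimately show ?thesis by (simp add: compact_eq_bounded_closed)
qed

lemma convex_std_simplex: "convex (std_simplex :: (real^'n) set)"
  unfolding convex_def std_simplex_def vec_nonneg_def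
  by (auto simp: sum.distrib sum_distrib_left[symmetric])

lemma std_simplex_fixpoint:
  assumes "continuous_on std_simplex f" "f ` std_simplex \<subseteq> (std_simplex :: (real^'n) set)"
  obtains x where "x \<in> std_simplex" "f x = x"
proof -
  have "(\<chi> i. 1 / real CARD('n)) \<in> (std_simplex :: (real^'n) set)"
    by (simp add: std_simplex_def vec_nonneg_def)
  then show ?thesis
    using brouwer[OF compact_std_simplex convex_std_simplex _ assms(1)] assms(2) that by blast
qed

text \<open>Brouwer's theorem applied to \<open>x \<mapsto> (M x + e) / \<Sum>\<^sub>i (M x + e)\<^sub>i\<close>; the
  perturbation \<open>e\<close> makes the fixed point strictly positive.\<close>

lemma perturbed_perron_vector:
  fixes M :: "real^'n^'n"
  assumes M: "mat_nonneg M" and e: "e > 0"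
  shows "\<exists>x c. x \<in> std_simplex \<and> (\<forall>i. 0 < x $ i) \<and> 0 \<le> c \<and>
    (\<forall>i. (M *v x) $ i + e = c * x $ i)"
proof -
  define d where "d x = (\<Sum>i\<in>UNIV. (M *v x) $ i + e)" for x :: "real^'n"
  define f where "f x = inverse (d x) *\<^sub>R (M *v x + e *\<^sub>R vec 1)" for x :: "real^'n"
  have pos: "0 < (M *v x) $ i + e" if "x \<in> std_simplex" for x i
    using vec_nonneg_matrix_vector_mult[OF M] that e
    by (auto simp: std_simplex_def vec_nonneg_def intro: add_nonneg_pos)
  then have dpos: "d x > 0" if "x \<in> std_simplex" for x
    unfolding d_def using that by (intro sum_pos) auto
  have "continuous_on std_simplex f"
    unfolding f_def d_def
    by (intro continuous_intros continuous_on_component) (use dpos in \<open>force simp: d_def\<close>)+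
  moreover have "f ` std_simplex \<subseteq> std_simplex"
  proof
    fix y assume "y \<in> f ` std_simplex"
    then obtain x where x: "x \<in> std_simplex" and y: "y = f x" by blast
    have "0 \<le> f x $ i" for i
      using pos[OF x, of i] dpos[OF x] by (simp add: f_def)
    moreover have "(\<Sum>i\<in>UNIV. f x $ i) = inverse (d x) * d x"
      by (simp add: f_def d_def sum_distrib_left)
    ultimately show "y \<in> std_simplex"
      using y dpos[OF x] by (simp add: std_simplex_def vec_nonneg_def)
  qed
  ultimately obtain x where x: "x \<in> std_simplex" "f x = x"
    by (rule std_simplex_fixpoint)
  have eq: "(M *v x) $ i + e = d x * x $ i" for i
    using arg_cong[OF x(2), of "\<lambda>y. y $ i"] dpos[OF x(1)] by (simp add: f_def field_simps)
  then have "0 < x $ i" for i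
    using pos[OF x(1), of i] dpos[OF x(1)] by (simp add: zero_less_mult_iff)
  with x(1) eq dpos[OF x(1)] show ?thesis by (intro exI[of _ x] exI[of _ "d x"]) auto
qed

lemma cmod_eigenvalue_le_of_positive_subeigenvector:
  fixes M :: "real^'n^'n"
  assumes M: "mat_nonneg M" and xpos: "\<forall>i. 0 < x $ i" and le: "\<forall>i. (M *v x) $ i \<le> c * x $ i"
    and l: "l \<in> complex_eigenvalues M"
  shows "cmod l \<le> c"
proof -
  obtain v where v: "v \<noteq> 0" "complex_of_matrix M *v v = l *s v"
    using l unfolding complex_eigenvalues_altdef by blast
  have comp: "l * v $ i = (\<Sum>j\<in>UNIV. complex_of_real (M $ i $ j) * v $ j)" for i
    using arg_cong[OF v(2), of "\<lambda>w. w $ i"]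
    by (simp add: matrix_vector_mult_def complex_of_matrix_def)
  define t where "t j = cmod (v $ j) / x $ j" for j
  obtain k where tk: "\<And>j. t j \<le> t k"
    using Max_in[of "range t"] Max_ge[of "range t"] by fastforce
  obtain j0 where "v $ j0 \<noteq> 0" using v(1) by (auto simp: vec_eq_iff)
  then have "t j0 > 0" using xpos by (simp add: t_def)
  then have tkpos: "t k > 0" using tk[of j0] by linarith
  have vb: "cmod (v $ j) \<le> t k * x $ j" for j
    using tk[of j] xpos by (simp add: t_def divide_le_eq)
  have vk: "cmod (v $ k) = t k * x $ k" using xpos[rule_format, of k] by (simp add: t_def)
  have "cmod l * cmod (v $ k) = cmod (\<Sum>j\<in>UNIV. complex_of_real (M $ k $ j) * v $ j)"
    using comp[of k] by (metis norm_mult)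
  also have "\<dots> \<le> (\<Sum>j\<in>UNIV. cmod (complex_of_real (M $ k $ j) * v $ j))"
    by (rule norm_sum)
  also have "\<dots> = (\<Sum>j\<in>UNIV. M $ k $ j * cmod (v $ j))"
    using M by (simp add: norm_mult mat_nonneg_def)
  also have "\<dots> \<le> (\<Sum>j\<in>UNIV. M $ k $ j * (t k * x $ j))"
    using M vb by (intro sum_mono mult_left_mono) (auto simp: mat_nonneg_def)
  also have "\<dots> = t k * (M *v x) $ k"
    by (simp add: matrix_vector_mult_def sum_distrib_left algebra_simps)
  also have "\<dots> \<le> c * cmod (v $ k)"
    using le tkpos vk by (simp add: mult_left_mono)
  finally have "cmod l * cmod (v $ k) \<le> c * cmod (v $ k)" .
  moreover have "cmod (v $ k) > 0" using vk tkpos xpos by simp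
  ultimately show ?thesis by simp
qed

lemma spectral_radius_le_of_positive_subeigenvector:
  fixes M :: "real^'n^'n"
  assumes "mat_nonneg M" "\<forall>i. 0 < x $ i" "\<forall>i. (M *v x) $ i \<le> c * x $ i"
  shows "spectral_radius M \<le> c"
  using spectral_radius_attained cmod_eigenvalue_le_of_positive_subeigenvector[OF assms] by metis

lemma real_eigenvalue_mem_complex_eigenvalues:
  assumes "x \<noteq> 0" "M *v x = c *s x"
  shows "complex_of_real c \<in> complex_eigenvalues M"
proof -
  let ?v = "\<chi> i. complex_of_real (x $ i)"
  have "?v \<noteq> 0" using assms(1) by (simp add: vec_eq_iff)
  moreover have "complex_of_matrix M *v ?v = complex_of_real c *s ?v"
    using arg_cong[OF assms(2), of "\<lambda>y. complex_of_real (y $ i)" for i]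
    by (simp add: vec_eq_iff complex_of_matrix_def matrix_vector_mult_def)
  ultimately show ?thesis unfolding complex_eigenvalues_altdef by blast
qed

lemma perturbed_eigenvalue_bounded:
  assumes M: "mat_nonneg M" and x: "x \<in> std_simplex" and "e \<le> 1"
    and eq: "\<forall>i. (M *v x) $ i + e = c * x $ i"
  shows "c \<le> (\<Sum>i\<in>UNIV. (\<Sum>j\<in>UNIV. M $ i $ j) + 1)"
proof -
  have "c = (\<Sum>i\<in>UNIV. c * x $ i)"
    using x by (simp add: std_simplex_def sum_distrib_left[symmetric])
  also have "\<dots> = (\<Sum>i\<in>UNIV. (M *v x) $ i + e)" using eq by simp
  also have "\<dots> \<le> (\<Sum>i\<in>UNIV. (\<Sum>j\<in>UNIV. M $ i $ j) + 1)"
  proof (rule sum_mono)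
    fix i
    have "(M *v x) $ i \<le> (\<Sum>j\<in>UNIV. M $ i $ j)"
      unfolding matrix_vector_mult_def using M std_simplex_component_le_1[OF x]
      by (auto simp: mat_nonneg_def intro!: sum_mono mult_left_le)
    with \<open>e \<le> 1\<close> show "(M *v x) $ i + e \<le> (\<Sum>j\<in>UNIV. M $ i $ j) + 1" by linarith
  qed
  finally show ?thesis .
qed

lemma eigen_equation_limit:
  fixes M :: "real^'n^'n"
  assumes limX: "X \<longlonglongrightarrow> x" and limC: "C \<longlonglongrightarrow> c" and limE: "E \<longlonglongrightarrow> 0"
    and eq: "\<And>k i. (M *v X k) $ i + E k = C k * X k $ i"
  shows "M *v x = c *s x"
proof -
  have "(M *v x) $ i = c * x $ i" for i
  proof -
    have "(\<lambda>k. (\<Sum>j\<in>UNIV. M $ i $ j * X k $ j) + E k) \<longlonglongrightarrow> (\<Sum>j\<in>UNIV. M $ i $ j * x $ j) + 0"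
      by (intro tendsto_add limE tendsto_sum tendsto_mult_left tendsto_vec_nth limX)
    moreover have "(\<lambda>k. C k * X k $ i) \<longlonglongrightarrow> c * x $ i"
      by (intro tendsto_mult limC tendsto_vec_nth limX)
    ultimately show ?thesis
      using eq LIMSEQ_unique by (simp add: matrix_vector_mult_def)
  qed
  then show ?thesis by (simp add: vec_eq_iff)
qed

text \<open>A limit of the perturbed eigenpairs is an eigenpair; its eigenvalue dominates all
  eigenvalues by the Collatz--Wielandt bound, so it is the spectral radius.\<close>

theorem perron_nonneg_eigenvector:
  fixes M :: "real^'n^'n"
  assumes M: "mat_nonneg M"
  obtains x where "vec_nonneg x" "x \<noteq> 0" "M *v x = spectral_radius M *s x"
proof -
  define E where "E k = inverse (real (Suc k))" for k :: nat
  have E_pos: "0 < E k" for k by (simp add: E_def)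
  define P where "P k x c \<longleftrightarrow> x \<in> std_simplex \<and> (\<forall>i. 0 < x $ i) \<and> 0 \<le> c \<and>
    (\<forall>i. (M *v x) $ i + E k = c * x $ i)" for k x c
  have "\<forall>k. \<exists>x c. P k x c"
    using perturbed_perron_vector[OF M E_pos] by (simp add: P_def)
  then obtain X where "\<forall>k. \<exists>c. P k (X k) c" by (rule choice[THEN exE])
  then obtain C where "\<forall>k. P k (X k) (C k)" by (rule choice[THEN exE])
  then have X: "\<And>k. X k \<in> std_simplex" "\<And>k i. 0 < X k $ i"
    and C: "\<And>k. 0 \<le> C k" and eq: "\<And>k i. (M *v X k) $ i + E k = C k * X k $ i"
    unfolding P_def by blast+
  have C_upper: "\<forall>i. (M *v X k) $ i \<le> C k * X k $ i" for k
    using eq[of k] E_pos[of k] by (metis less_add_same_cancel1 less_imp_le)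
  define B where "B = (\<Sum>i\<in>UNIV. (\<Sum>j\<in>UNIV. M $ i $ j) + 1)"
  have "C k \<le> B" for k
    unfolding B_def
  proof (rule perturbed_eigenvalue_bounded[OF M X(1)])
    show "E k \<le> 1" by (simp add: E_def field_simps)
    show "\<forall>i. (M *v X k) $ i + E k = C k * X k $ i" using eq by blast
  qed
  then have mem: "(X k, C k) \<in> std_simplex \<times> {0..B}" for k using X(1) C by auto
  have "seq_compact (std_simplex \<times> {0..B})"
    using compact_std_simplex by (intro compact_imp_seq_compact compact_Times) auto
  then obtain l r where l: "l \<in> std_simplex \<times> {0..B}" and r: "strict_mono r"
    and lim: "((\<lambda>k. (X k, C k)) \<circ> r) \<longlonglongrightarrow> l"
    unfolding seq_compact_def using mem by (auto dest!: spec[of _ "\<lambda>k. (X k, C k)"])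
  obtain x c where lxc: "l = (x, c)" by (cases l)
  have limX: "(\<lambda>k. X (r k)) \<longlonglongrightarrow> x" using tendsto_fst[OF lim] by (simp add: o_def lxc)
  have limC: "(\<lambda>k. C (r k)) \<longlonglongrightarrow> c" using tendsto_snd[OF lim] by (simp add: o_def lxc)
  have "(\<lambda>k. E (r k)) \<longlonglongrightarrow> 0"
    using LIMSEQ_subseq_LIMSEQ[OF LIMSEQ_inverse_real_of_nat r] by (simp add: E_def o_def)
  then have Mx: "M *v x = c *s x" by (rule eigen_equation_limit[OF limX limC _ eq])
  have x: "x \<in> std_simplex" "0 \<le> c" using l lxc by auto
  have "spectral_radius M \<le> C k" for k
    by (rule spectral_radius_le_of_positive_subeigenvector[OF M _ C_upper]) (simp add: X(2))
  then have "spectral_radius M \<le> c" by (intro LIMSEQ_le_const[OF limC]) auto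
  moreover have "c \<le> spectral_radius M"
    using cmod_eigenvalue_le_spectral_radius[OF real_eigenvalue_mem_complex_eigenvalues[OF
        std_simplex_nonzero[OF x(1)] Mx]] x(2) by simp
  ultimately show ?thesis
    using that[of x] Mx x(1) by (auto simp: std_simplex_def std_simplex_nonzero)
qed

section \<open>Existence of the Moore--Penrose inverse\<close>

definition orth_proj :: "'a::euclidean_space set \<Rightarrow> 'a \<Rightarrow> 'a" where
  "orth_proj S x = (SOME y. y \<in> S \<and> (\<forall>w\<in>S. (x - y) \<bullet> w = 0))"

lemma orth_proj:
  assumes "subspace S"
  shows orth_proj_in: "orth_proj S x \<in> S"
    and orth_proj_orthogonal: "w \<in> S \<Longrightarrow> (x - orth_proj S x) \<bullet> w = 0"
proof -
  obtain y z where "y \<in> span S" "\<And>w. w \<in> span S \<Longrightarrow> orthogonal z w" "x = y + z"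
    using orthogonal_subspace_decomp_exists[of S x] by blast
  moreover have "span S = S" using assms by (simp add: span_eq_iff)
  ultimately have "\<exists>y. y \<in> S \<and> (\<forall>w\<in>S. (x - y) \<bullet> w = 0)"
    by (intro exI[of _ y]) (auto simp: orthogonal_def)
  from someI_ex[OF this] show "orth_proj S x \<in> S" "w \<in> S \<Longrightarrow> (x - orth_proj S x) \<bullet> w = 0"
    unfolding orth_proj_def[symmetric] by auto
qed

lemma orth_proj_unique:
  assumes S: "subspace S" and y: "y \<in> S" "\<forall>w\<in>S. (x - y) \<bullet> w = 0"
  shows "orth_proj S x = y"
proof -
  let ?d = "orth_proj S x - y"
  have "?d \<in> S" using S y(1) orth_proj_in[OF S] by (simp add: subspace_diff)
  moreover have "?d \<bullet> w = 0" if "w \<in> S" for w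
    using y(2) that orth_proj_orthogonal[OF S that, of x]
    by (simp add: inner_diff_left algebra_simps)
  ultimately show ?thesis by (metis inner_eq_zero_iff right_minus_eq)
qed

lemma orth_proj_id: "subspace S \<Longrightarrow> x \<in> S \<Longrightarrow> orth_proj S x = x"
  by (rule orth_proj_unique) auto

lemma orth_proj_inner_commute:
  assumes S: "subspace S"
  shows "orth_proj S x \<bullet> z = x \<bullet> orth_proj S z"
proof -
  have "(x - orth_proj S x) \<bullet> orth_proj S z = 0" "(z - orth_proj S z) \<bullet> orth_proj S x = 0"
    by (intro orth_proj_orthogonal[OF S] orth_proj_in[OF S])+
  then have "x \<bullet> orth_proj S z = orth_proj S x \<bullet> orth_proj S z"
    "z \<bullet> orth_proj S x = orth_proj S z \<bullet> orth_proj S x"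
    by (simp_all add: inner_diff_left)
  then show ?thesis by (metis inner_commute)
qed

lemma orth_proj_add:
  assumes S: "subspace S"
  shows "orth_proj S (x + y) = orth_proj S x + orth_proj S y"
proof (rule orth_proj_unique[OF S])
  show "orth_proj S x + orth_proj S y \<in> S" by (intro subspace_add[OF S] orth_proj_in[OF S])
  show "\<forall>w\<in>S. (x + y - (orth_proj S x + orth_proj S y)) \<bullet> w = 0"
  proof
    fix w assume "w \<in> S"
    then have "(x - orth_proj S x) \<bullet> w = 0" "(y - orth_proj S y) \<bullet> w = 0"
      by (simp_all add: orth_proj_orthogonal[OF S])
    moreover have "x + y - (orth_proj S x + orth_proj S y) = (x - orth_proj S x) + (y - orth_proj S y)"
      by simp
    ultimately show "(x + y - (orth_proj S x + orth_proj S y)) \<bullet> w = 0"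
      by (simp only: inner_add_left)
  qed
qed

lemma orth_proj_scale:
  assumes S: "subspace S"
  shows "orth_proj S (c *\<^sub>R x) = c *\<^sub>R orth_proj S x"
proof (rule orth_proj_unique[OF S])
  show "c *\<^sub>R orth_proj S x \<in> S" by (intro subspace_scale[OF S] orth_proj_in[OF S])
  show "\<forall>w\<in>S. (c *\<^sub>R x - c *\<^sub>R orth_proj S x) \<bullet> w = 0"
  proof
    fix w assume "w \<in> S"
    then have "(x - orth_proj S x) \<bullet> w = 0" by (rule orth_proj_orthogonal[OF S])
    then show "(c *\<^sub>R x - c *\<^sub>R orth_proj S x) \<bullet> w = 0"
      by (metis inner_scaleR_left mult_zero_right scaleR_right_diff_distrib)
  qed
qed

lemma transpose_eq_self_if_self_adjoint:
  fixes M :: "real^'n^'n"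
  assumes "\<And>y z. (M *v y) \<bullet> z = y \<bullet> (M *v z)"
  shows "transpose M = M"
proof -
  have "adjoint (\<lambda>x. M *v x) = (\<lambda>x. M *v x)" using assms by (intro adjoint_unique) blast
  then have "(\<lambda>x. transpose M *v x) = (\<lambda>x. M *v x)" by (metis adjoint_matrix)
  then show ?thesis by (metis matrix_of_matrix_vector_mul)
qed

text \<open>The minimum-norm least-squares solution of \<open>A x = y\<close>: the solution of
  \<open>A x = P y\<close> orthogonal to the kernel of \<open>A\<close>, where \<open>P\<close> is the orthogonal projection
  onto the range of \<open>A\<close>.\<close>

definition mp_solution :: "real^'n^'m \<Rightarrow> real^'m \<Rightarrow> real^'n" where
  "mp_solution A y =
    (THE x. (\<forall>w. A *v w = 0 \<longrightarrow> x \<bullet> w = 0) \<and> A *v x = orth_proj (range ((*v) A)) y)"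

lemma subspace_kernel_matrix: "subspace {x. (A::real^'n^'m) *v x = 0}"
  using real_vector.linear_subspace_kernel[OF matrix_vector_mul_linear[of A]] by simp

lemma subspace_range_matrix: "subspace (range ((*v) (A::real^'n^'m)))"
  using real_vector.linear_subspace_image[OF matrix_vector_mul_linear[of A] subspace_UNIV] by simp

lemma kernel_orthogonal_solutions_eq:
  fixes A :: "real^'n^'m"
  assumes "\<forall>w. A *v w = 0 \<longrightarrow> x \<bullet> w = 0" "\<forall>w. A *v w = 0 \<longrightarrow> x' \<bullet> w = 0"
    and "A *v x = A *v x'"
  shows "x = x'"
proof -
  let ?d = "x - x'"
  have "A *v ?d = 0" using assms(3) by (simp add: matrix_vector_mult_diff_distrib)
  then have "x \<bullet> ?d = 0 \<and> x' \<bullet> ?d = 0" using assms(1,2) by blast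
  then have "?d \<bullet> ?d = 0" by (simp only: inner_diff_left)
  then show ?thesis by simp
qed

lemma mp_solution_char:
  fixes A :: "real^'n^'m"
  shows "(\<forall>w. A *v w = 0 \<longrightarrow> mp_solution A y \<bullet> w = 0) \<and>
    A *v mp_solution A y = orth_proj (range ((*v) A)) y"
proof -
  let ?N = "{x. A *v x = (0::real^'m)}"
  let ?P = "\<lambda>x. (\<forall>w. A *v w = 0 \<longrightarrow> x \<bullet> w = 0) \<and> A *v x = orth_proj (range ((*v) A)) y"
  obtain z where z: "A *v z = orth_proj (range ((*v) A)) y"
    using orth_proj_in[OF subspace_range_matrix[of A], of y] by auto
  let ?x = "z - orth_proj ?N z"
  have ex: "?P ?x"
  proof
    show "\<forall>w. A *v w = 0 \<longrightarrow> ?x \<bullet> w = 0"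
      using orth_proj_orthogonal[OF subspace_kernel_matrix[of A]] by auto
    have "A *v orth_proj ?N z = 0" using orth_proj_in[OF subspace_kernel_matrix[of A], of z] by simp
    then show "A *v ?x = orth_proj (range ((*v) A)) y"
      using z by (simp add: matrix_vector_mult_diff_distrib)
  qed
  have "?P x' \<Longrightarrow> x' = ?x" for x'
    using ex kernel_orthogonal_solutions_eq[of A x' ?x] by argo
  then have "?P (THE x. ?P x)" by (rule theI[of ?P ?x, OF ex])
  then show ?thesis unfolding mp_solution_def .
qed

lemma mp_solution_unique:
  fixes A :: "real^'n^'m"
  assumes "\<forall>w. A *v w = 0 \<longrightarrow> x \<bullet> w = 0" "A *v x = orth_proj (range ((*v) A)) y"
  shows "mp_solution A y = x"
  using mp_solution_char[of A y] assms kernel_orthogonal_solutions_eq[of A "mp_solution A y" x]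
  by argo

lemma linear_mp_solution: "linear (mp_solution A)"
proof (rule linearI)
  fix y1 y2
  show "mp_solution A (y1 + y2) = mp_solution A y1 + mp_solution A y2"
  proof (rule mp_solution_unique)
    show "\<forall>w. A *v w = 0 \<longrightarrow> (mp_solution A y1 + mp_solution A y2) \<bullet> w = 0"
      using mp_solution_char[of A y1] mp_solution_char[of A y2] by (simp add: inner_add_left)
    have "orth_proj (range ((*v) A)) (y1 + y2) =
        orth_proj (range ((*v) A)) y1 + orth_proj (range ((*v) A)) y2"
      by (rule orth_proj_add[OF subspace_range_matrix])
    then show "A *v (mp_solution A y1 + mp_solution A y2) = orth_proj (range ((*v) A)) (y1 + y2)"
      using mp_solution_char[of A y1] mp_solution_char[of A y2] by (simp add: matrix_vector_right_distrib)
  qed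
next
  fix c :: real and y
  show "mp_solution A (c *\<^sub>R y) = c *\<^sub>R mp_solution A y"
  proof (rule mp_solution_unique)
    show "\<forall>w. A *v w = 0 \<longrightarrow> (c *\<^sub>R mp_solution A y) \<bullet> w = 0"
      using mp_solution_char[of A y] by simp
    have "orth_proj (range ((*v) A)) (c *\<^sub>R y) = c *\<^sub>R orth_proj (range ((*v) A)) y"
      by (rule orth_proj_scale[OF subspace_range_matrix])
    then show "A *v (c *\<^sub>R mp_solution A y) = orth_proj (range ((*v) A)) (c *\<^sub>R y)"
      using mp_solution_char[of A y] by (simp add: matrix_vector_mult_scaleR)
  qed
qed

definition is_mp_inverse :: "real^'n^'m \<Rightarrow> real^'m^'n \<Rightarrow> bool" where
  "is_mp_inverse A X \<longleftrightarrow> A ** X ** A = A \<and> X ** A ** X = X \<and>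
      transpose (A ** X) = A ** X \<and> transpose (X ** A) = X ** A"

lemma matrix_mp_solution: "matrix (mp_solution A) *v y = mp_solution A y"
  using linear_mp_solution[of A] by (simp add: matrix_works linear_linear)

lemma mp_solution_image: "mp_solution A (A *v z) = z - orth_proj {x. A *v x = 0} z"
proof (rule mp_solution_unique)
  let ?N = "{x. A *v x = 0}"
  show "\<forall>w. A *v w = 0 \<longrightarrow> (z - orth_proj ?N z) \<bullet> w = 0"
    using orth_proj_orthogonal[OF subspace_kernel_matrix[of A], of _ z] by blast
  have "A *v orth_proj ?N z = 0" using orth_proj_in[OF subspace_kernel_matrix[of A], of z] by simp
  then show "A *v (z - orth_proj ?N z) = orth_proj (range ((*v) A)) (A *v z)"
    using orth_proj_id[OF subspace_range_matrix[of A], of "A *v z"]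
    by (simp add: matrix_vector_mult_diff_distrib)
qed

lemma mp_solution_idem: "mp_solution A (A *v mp_solution A y) = mp_solution A y"
proof (rule mp_solution_unique)
  show "\<forall>w. A *v w = 0 \<longrightarrow> mp_solution A y \<bullet> w = 0" using mp_solution_char[of A y] by blast
  show "A *v mp_solution A y = orth_proj (range ((*v) A)) (A *v mp_solution A y)"
    by (rule orth_proj_id[OF subspace_range_matrix, symmetric]) simp
qed

lemma is_mp_inverse_matrix_mp_solution: "is_mp_inverse A (matrix (mp_solution A))"
proof -
  let ?X = "matrix (mp_solution A)"
  let ?R = "range ((*v) A)" and ?N = "{x. A *v x = 0}"
  have AX: "(A ** ?X) *v y = orth_proj ?R y" for y
    using mp_solution_char[of A y] by (simp add: matrix_vector_mul_assoc[symmetric] matrix_mp_solution)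
  have XA: "(?X ** A) *v z = z - orth_proj ?N z" for z
    by (simp add: matrix_vector_mul_assoc[symmetric] matrix_mp_solution mp_solution_image)
  have "(A ** ?X ** A) *v z = A *v z" for z
    using AX[of "A *v z"] orth_proj_id[OF subspace_range_matrix, of "A *v z" A]
    by (simp add: matrix_vector_mul_assoc[symmetric])
  then have "A ** ?X ** A = A" by (simp add: matrix_eq)
  moreover have "(?X ** A ** ?X) *v y = ?X *v y" for y
    by (simp add: matrix_vector_mul_assoc[symmetric] matrix_mp_solution mp_solution_idem)
  then have "?X ** A ** ?X = ?X" by (simp add: matrix_eq)
  moreover have "transpose (A ** ?X) = A ** ?X"
    by (rule transpose_eq_self_if_self_adjoint)
      (simp add: AX orth_proj_inner_commute[OF subspace_range_matrix])
  moreover have "transpose (?X ** A) = ?X ** A"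
    by (rule transpose_eq_self_if_self_adjoint)
      (simp add: XA inner_diff_left inner_diff_right orth_proj_inner_commute[OF subspace_kernel_matrix])
  ultimately show ?thesis by (simp add: is_mp_inverse_def)
qed

lemma is_mp_inverse_transpose_identities:
  assumes "is_mp_inverse A X"
  shows "X ** transpose X ** transpose A = X" "transpose A ** transpose X ** X = X"
    and "transpose A ** A ** X = transpose A" "X ** A ** transpose A = transpose A"
proof -
  have 1: "A ** X ** A = A" and 2: "X ** A ** X = X" and 3: "transpose (A ** X) = A ** X"
    and 4: "transpose (X ** A) = X ** A" using assms by (auto simp: is_mp_inverse_def)
  have "X ** transpose X ** transpose A = X ** transpose (A ** X)"
    by (simp add: matrix_transpose_mul matrix_mul_assoc)
  also have "\<dots> = X" using 2 3 by (simp add: matrix_mul_assoc)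
  finally show "X ** transpose X ** transpose A = X" .
  have "transpose A ** transpose X ** X = transpose (X ** A) ** X"
    by (simp add: matrix_transpose_mul)
  also have "\<dots> = X" using 2 4 by simp
  finally show "transpose A ** transpose X ** X = X" .
  have "transpose A ** A ** X = transpose A ** transpose (A ** X)"
    using 3 by (simp add: matrix_mul_assoc)
  also have "\<dots> = transpose (A ** X ** A)" by (rule matrix_transpose_mul[symmetric])
  also have "\<dots> = transpose A" using 1 by simp
  finally show "transpose A ** A ** X = transpose A" .
  have "X ** A ** transpose A = transpose (A ** (X ** A))"
    using 4 by (simp add: matrix_transpose_mul)
  also have "\<dots> = transpose A" using 1 by (simp add: matrix_mul_assoc)
  finally show "X ** A ** transpose A = transpose A" .
qed

lemma is_mp_inverse_unique:
  assumes X: "is_mp_inverse A X" and Y: "is_mp_inverse A Y"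
  shows "X = Y"
proof -
  note X_ids = is_mp_inverse_transpose_identities[OF X]
    and Y_ids = is_mp_inverse_transpose_identities[OF Y]
  have "X ** A ** Y = (X ** transpose X ** transpose A) ** A ** Y" using X_ids(1) by simp
  also have "\<dots> = (X ** transpose X) ** (transpose A ** A ** Y)" by (simp add: matrix_mul_assoc)
  also have "\<dots> = X" using X_ids(1) Y_ids(3) by simp
  finally have XAY_X: "X ** A ** Y = X" .
  have "X ** A ** Y = (X ** A) ** (transpose A ** transpose Y ** Y)" using Y_ids(2) by simp
  also have "\<dots> = (X ** A ** transpose A) ** transpose Y ** Y" by (simp add: matrix_mul_assoc)
  also have "\<dots> = Y" using X_ids(4) Y_ids(2) by simp
  finally show ?thesis using XAY_X by simp
qed

lemma is_mp_inverse_mp_inverse: "is_mp_inverse A (mp_inverse A)"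
proof -
  have "\<exists>!X. is_mp_inverse A X"
    using is_mp_inverse_matrix_mp_solution is_mp_inverse_unique by blast
  then have "is_mp_inverse A (THE X. is_mp_inverse A X)" by (rule theI')
  then show ?thesis unfolding mp_inverse_def is_mp_inverse_def[abs_def] by simp
qed

lemma mp_inverse_AXA: "A ** mp_inverse A ** A = A"
  and mp_inverse_XAX: "mp_inverse A ** A ** mp_inverse A = mp_inverse A"
  and mp_inverse_AX_symmetric: "transpose (A ** mp_inverse A) = A ** mp_inverse A"
  and mp_inverse_XA_symmetric: "transpose (mp_inverse A ** A) = mp_inverse A ** A"
  using is_mp_inverse_mp_inverse[of A] by (auto simp: is_mp_inverse_def)

section \<open>Proper splittings\<close>

lemma matrix_diff_ldistrib: "(A::real^'n^'m) ** (B - C) = A ** B - A ** C"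
  by (simp add: matrix_matrix_mult_def vec_eq_iff sum_subtractf algebra_simps)

lemma matrix_diff_rdistrib: "((B::real^'n^'m) - C) ** (D::real^'k^'n) = B ** D - C ** D"
  by (simp add: matrix_matrix_mult_def vec_eq_iff sum_subtractf algebra_simps)

lemma mp_inverse_range_absorb:
  fixes P :: "real^'n^'m" and Q :: "real^'k^'m"
  assumes "mat_range P \<subseteq> mat_range Q"
  shows "Q ** mp_inverse Q ** P = P"
proof -
  have "(Q ** mp_inverse Q ** P) *v z = P *v z" for z
  proof -
    obtain w where w: "P *v z = Q *v w" using assms unfolding mat_range_def by blast
    have "(Q ** mp_inverse Q ** P) *v z = (Q ** mp_inverse Q ** Q) *v w"
      by (simp add: w matrix_vector_mul_assoc[symmetric])
    also have "\<dots> = P *v z" by (simp add: mp_inverse_AXA w)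
    finally show ?thesis .
  qed
  then show ?thesis by (simp add: matrix_eq)
qed

lemma mp_inverse_null_absorb:
  fixes P :: "real^'n^'m" and Q :: "real^'n^'k"
  assumes "mat_null Q \<subseteq> mat_null P"
  shows "P ** mp_inverse Q ** Q = P"
proof -
  have "(P ** mp_inverse Q ** Q) *v z = P *v z" for z
  proof -
    let ?w = "z - (mp_inverse Q ** Q) *v z"
    have "Q *v ?w = Q *v z - (Q ** mp_inverse Q ** Q) *v z"
      by (simp add: matrix_vector_mult_diff_distrib matrix_vector_mul_assoc matrix_mul_assoc)
    also have "\<dots> = 0" by (simp add: mp_inverse_AXA)
    finally have "P *v ?w = 0" using assms by (auto simp: mat_null_def)
    then show ?thesis
      by (simp add: matrix_vector_mult_diff_distrib matrix_vector_mul_assoc matrix_mul_assoc)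
  qed
  then show ?thesis by (simp add: matrix_eq)
qed

lemma mp_inverse_absorb_left:
  fixes Q :: "real^'n^'m" and P :: "real^'n^'k"
  assumes "mat_null Q \<subseteq> mat_null P"
  shows "mp_inverse Q ** Q ** mp_inverse P = mp_inverse P"
proof -
  let ?Y = "mp_inverse P"
  have Y: "transpose P ** transpose ?Y ** ?Y = ?Y"
    by (metis matrix_transpose_mul mp_inverse_XAX mp_inverse_XA_symmetric)
  have "mp_inverse Q ** Q ** transpose P = transpose (P ** (mp_inverse Q ** Q))"
    by (metis matrix_transpose_mul mp_inverse_XA_symmetric)
  also have "\<dots> = transpose P"
    using mp_inverse_null_absorb[OF assms] by (simp add: matrix_mul_assoc)
  finally have "mp_inverse Q ** Q ** (transpose P ** transpose ?Y ** ?Y) = transpose P ** transpose ?Y ** ?Y"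
    by (metis matrix_mul_assoc)
  then show ?thesis using Y by simp
qed

lemma mp_inverse_absorb_right:
  fixes Q :: "real^'n^'m" and P :: "real^'k^'m"
  assumes "mat_range Q \<subseteq> mat_range P"
  shows "mp_inverse Q ** P ** mp_inverse P = mp_inverse Q"
proof -
  let ?X = "mp_inverse Q"
  have X: "?X ** transpose ?X ** transpose Q = ?X"
    by (metis matrix_mul_assoc matrix_transpose_mul mp_inverse_AX_symmetric mp_inverse_XAX)
  have "transpose Q ** P ** mp_inverse P = transpose (P ** mp_inverse P ** Q)"
    by (metis matrix_transpose_mul mp_inverse_AX_symmetric matrix_mul_assoc)
  also have "\<dots> = transpose Q" using mp_inverse_range_absorb[OF assms] by simp
  finally have "(?X ** transpose ?X ** transpose Q) ** P ** mp_inverse P = ?X ** transpose ?X ** transpose Q"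
    by (metis matrix_mul_assoc)
  then show ?thesis using X by simp
qed

lemma proper_splitting_mp_inverse_left:
  assumes "proper_splitting A U V"
  shows "mp_inverse A = mp_inverse U + mp_inverse U ** V ** mp_inverse A"
proof -
  have "V = U - A" and "mat_null U \<subseteq> mat_null A" and "mat_range U \<subseteq> mat_range A"
    using assms by (auto simp: proper_splitting_def)
  then have "mp_inverse U ** V ** mp_inverse A = mp_inverse A - mp_inverse U"
    by (simp add: matrix_diff_ldistrib matrix_diff_rdistrib mp_inverse_absorb_left mp_inverse_absorb_right)
  then show ?thesis by simp
qed

lemma proper_splitting_mp_inverse_right:
  assumes "proper_splitting A U V"
  shows "mp_inverse A = mp_inverse U + mp_inverse A ** V ** mp_inverse U"
proof -
  have "V = U - A" and "mat_null A \<subseteq> mat_null U" and "mat_range A \<subseteq> mat_range U"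
    using assms by (auto simp: proper_splitting_def)
  then have "mp_inverse A ** V ** mp_inverse U = mp_inverse A - mp_inverse U"
    by (simp add: matrix_diff_ldistrib matrix_diff_rdistrib mp_inverse_absorb_left mp_inverse_absorb_right)
  then show ?thesis by simp
qed

section \<open>Comparison of the spectral radii\<close>

lemma less_1_if_nonneg_scaled:
  assumes "vec_nonneg p" "vec_nonneg w" "p = (1 - r) *\<^sub>R w" "p \<noteq> 0"
  shows "r < 1"
proof (rule ccontr)
  assume "\<not> r < 1"
  then have "p $ i \<le> 0" for i using assms(2,3) by (simp add: vec_nonneg_def mult_nonpos_nonneg)
  then have "p = 0" using assms(1) by (simp add: vec_nonneg_def vec_eq_iff order_antisym)
  with assms(4) show False by simp
qed

lemma pwr_splitting_I_perron_vector:
  fixes A U V :: "real^'n^'m"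
  defines "r \<equiv> spectral_radius (mp_inverse U ** V)"
  assumes splitting: "pwr_splitting_I A U V" and A: "mat_nonneg (mp_inverse A)" and r: "r > 0"
  obtains y where "vec_nonneg y" "y \<noteq> 0" "vec_nonneg (y v* mp_inverse U)"
    "(y v* mp_inverse U) v* V = r *\<^sub>R y" "y v* mp_inverse U = (1 - r) *\<^sub>R (y v* mp_inverse A)"
    "r < 1"
proof -
  let ?X = "mp_inverse U" and ?Y = "mp_inverse A"
  have X: "mat_nonneg ?X" and XV: "mat_nonneg (?X ** V)" and proper: "proper_splitting A U V"
    using splitting by (auto simp: pwr_splitting_I_def)
  have "mat_nonneg (transpose (?X ** V))"
    using XV by (simp add: mat_nonneg_def transpose_def)
  then obtain y where "vec_nonneg y" "y \<noteq> 0"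
    "transpose (?X ** V) *v y = spectral_radius (transpose (?X ** V)) *s y"
    by (rule perron_nonneg_eigenvector)
  then have y: "vec_nonneg y" "y \<noteq> 0" "y v* (?X ** V) = r *\<^sub>R y"
    by (simp_all add: r_def spectral_radius_transpose scalar_mult_eq_scaleR)
  let ?p = "y v* ?X"
  have pV: "?p v* V = r *\<^sub>R y" using y(3) by (simp add: vector_matrix_mul_assoc)
  have "y v* ?Y = y v* (?X + ?X ** V ** ?Y)"
    using proper_splitting_mp_inverse_left[OF proper] by simp
  also have "\<dots> = ?p + r *\<^sub>R (y v* ?Y)"
    by (simp add: vector_matrix_mult_add_rdistrib vector_matrix_mul_assoc[symmetric] pV
        scaleR_vector_matrix_assoc)
  finally have p: "?p = (1 - r) *\<^sub>R (y v* ?Y)"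
    by (simp add: algebra_simps)
  have "?p \<noteq> 0" using pV r y(2) by auto
  with p have "r < 1"
    using vec_nonneg_vector_matrix_mult[OF X y(1)] vec_nonneg_vector_matrix_mult[OF A y(1)]
    by (intro less_1_if_nonneg_scaled)
  then show ?thesis
    using that y(1,2) pV p vec_nonneg_vector_matrix_mult[OF X y(1)] by blast
qed

lemma pwr_splitting_II_perron_vector:
  fixes A U V :: "real^'n^'m"
  defines "r \<equiv> spectral_radius (mp_inverse U ** V)"
  assumes splitting: "pwr_splitting_II A U V" and A: "mat_nonneg (mp_inverse A)" and r: "r > 0"
  obtains x where "vec_nonneg x" "x \<noteq> 0" "vec_nonneg (mp_inverse U *v x)"
    "V *v (mp_inverse U *v x) = r *\<^sub>R x" "mp_inverse U *v x = (1 - r) *\<^sub>R (mp_inverse A *v x)"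
    "r < 1"
proof -
  let ?X = "mp_inverse U" and ?Y = "mp_inverse A"
  have X: "mat_nonneg ?X" and VX: "mat_nonneg (V ** ?X)" and proper: "proper_splitting A U V"
    using splitting by (auto simp: pwr_splitting_II_def)
  obtain x where "vec_nonneg x" "x \<noteq> 0" "(V ** ?X) *v x = spectral_radius (V ** ?X) *s x"
    by (rule perron_nonneg_eigenvector[OF VX])
  moreover have "spectral_radius (V ** ?X) = r"
    using r unfolding r_def by (rule spectral_radius_mult_commute)
  ultimately have x: "vec_nonneg x" "x \<noteq> 0" "(V ** ?X) *v x = r *\<^sub>R x"
    by (simp_all add: scalar_mult_eq_scaleR)
  let ?q = "?X *v x"
  have Vq: "V *v ?q = r *\<^sub>R x" using x(3) by (simp add: matrix_vector_mul_assoc)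
  have "?Y *v x = (?X + ?Y ** V ** ?X) *v x"
    using proper_splitting_mp_inverse_right[OF proper] by simp
  also have "\<dots> = ?q + r *\<^sub>R (?Y *v x)"
    by (simp add: matrix_vector_mult_add_rdistrib matrix_vector_mul_assoc[symmetric] Vq
        matrix_vector_mult_scaleR)
  finally have q: "?q = (1 - r) *\<^sub>R (?Y *v x)"
    by (simp add: algebra_simps)
  have "?q \<noteq> 0" using Vq r x(2) by auto
  with q have "r < 1"
    using vec_nonneg_matrix_vector_mult[OF X x(1)] vec_nonneg_matrix_vector_mult[OF A x(1)]
    by (intro less_1_if_nonneg_scaled)
  then show ?thesis
    using that x(1,2) Vq q vec_nonneg_matrix_vector_mult[OF X x(1)] by blast
qed

lemma perron_vectors_pairing:
  fixes Va Vb :: "real^'n^'m" and Ya Yb :: "real^'m^'n"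
  assumes p: "p v* Va = ra *\<^sub>R y" "p = (1 - ra) *\<^sub>R (y v* Ya)"
    and q: "Vb *v q = rb *\<^sub>R x" "q = (1 - rb) *\<^sub>R (Yb *v x)"
  shows "p \<bullet> (Va *v q) = ra * (1 - rb) * (y \<bullet> (Yb *v x))"
    and "p \<bullet> (Vb *v q) = rb * (1 - ra) * (y \<bullet> (Ya *v x))"
proof -
  have "p \<bullet> (Va *v q) = (p v* Va) \<bullet> q" by (rule dot_lmul_matrix[symmetric])
  also have "\<dots> = (ra *\<^sub>R y) \<bullet> ((1 - rb) *\<^sub>R (Yb *v x))" using p(1) q(2) by simp
  finally show "p \<bullet> (Va *v q) = ra * (1 - rb) * (y \<bullet> (Yb *v x))" by simp
  have "p \<bullet> (Vb *v q) = ((1 - ra) *\<^sub>R (y v* Ya)) \<bullet> (rb *\<^sub>R x)" using p(2) q(1) by simp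
  also have "\<dots> = rb * (1 - ra) * ((y v* Ya) \<bullet> x)" by simp
  finally show "p \<bullet> (Vb *v q) = rb * (1 - ra) * (y \<bullet> (Ya *v x))" by (simp add: dot_lmul_matrix)
qed

lemma inner_matrix_vector_mono:
  fixes V1 V2 :: "real^'n^'m"
  assumes "vec_nonneg p" "vec_nonneg q" "mat_le V1 V2"
  shows "p \<bullet> (V1 *v q) \<le> p \<bullet> (V2 *v q)"
  using assms unfolding inner_vec_def matrix_vector_mult_def inner_real_def
  by (auto simp: mat_le_def vec_nonneg_def intro!: sum_mono mult_left_mono mult_right_mono)

lemma inner_matrix_vector_nonneg:
  fixes Y :: "real^'n^'m"
  assumes "vec_nonneg y" "vec_nonneg x" "mat_nonneg Y"
  shows "0 \<le> y \<bullet> (Y *v x)"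
  using assms unfolding inner_vec_def matrix_vector_mult_def inner_real_def
  by (auto simp: mat_nonneg_def vec_nonneg_def intro!: sum_nonneg mult_nonneg_nonneg)

lemma inner_matrix_vector_strict_mono:
  fixes Y1 Y2 :: "real^'n^'m"
  assumes y: "vec_nonneg y" "y \<noteq> 0" and x: "vec_nonneg x" "x \<noteq> 0" and gt: "mat_gt Y2 Y1"
  shows "y \<bullet> (Y1 *v x) < y \<bullet> (Y2 *v x)"
proof -
  obtain i0 where i0: "y $ i0 > 0"
    using y by (metis order_le_neq_trans vec_eq_iff zero_index vec_nonneg_def)
  obtain j0 where j0: "x $ j0 > 0"
    using x by (metis order_le_neq_trans vec_eq_iff zero_index vec_nonneg_def)
  let ?D = "Y2 - Y1"
  have D: "0 < ?D $ i $ j" for i j using gt by (simp add: mat_gt_def)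
  have Dx: "0 \<le> ?D $ i $ j * x $ j" for i j
    using D[of i j] x(1) by (simp add: vec_nonneg_def)
  then have row: "0 \<le> (\<Sum>j\<in>UNIV. ?D $ i $ j * x $ j)" for i
    by (simp add: sum_nonneg)
  have "0 < (\<Sum>j\<in>UNIV. ?D $ i0 $ j * x $ j)"
    using D[of i0 j0] j0 Dx by (intro sum_pos2[of UNIV j0]) auto
  then have "0 < (\<Sum>i\<in>UNIV. y $ i * (\<Sum>j\<in>UNIV. ?D $ i $ j * x $ j))"
    using i0 row y(1) by (intro sum_pos2[of UNIV i0]) (auto simp: vec_nonneg_def)
  also have "\<dots> = y \<bullet> (?D *v x)"
    by (simp add: inner_vec_def matrix_vector_mult_def)
  also have "\<dots> = y \<bullet> (Y2 *v x) - y \<bullet> (Y1 *v x)"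
    by (simp add: matrix_vector_mult_diff_rdistrib inner_diff_right)
  finally show ?thesis by simp
qed

lemma less_of_cross_weighted_le:
  fixes r s a1 a2 :: real
  assumes "0 < r" "0 < s" "r < 1" "s < 1" "0 \<le> a1" "a1 < a2"
    and "r * (1 - s) * a2 \<le> s * (1 - r) * a1"
  shows "r < s"
proof (rule ccontr)
  assume "\<not> r < s"
  then have "s * (1 - r) \<le> r * (1 - s)" by (simp add: algebra_simps)
  have "0 < s * (1 - r)" using assms by simp
  then have "s * (1 - r) * a1 < s * (1 - r) * a2"
    by (rule mult_strict_left_mono[OF assms(6)])
  also have "\<dots> \<le> r * (1 - s) * a2"
    using \<open>s * (1 - r) \<le> r * (1 - s)\<close> assms(5,6) by (intro mult_right_mono) auto
  finally show False using assms(7) by simp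
qed

lemma splittings_of_different_types_cross_inequality:
  fixes A1 A2 U1 V1 U2 V2 :: "real^'n^'m"
  defines "r1 \<equiv> spectral_radius (mp_inverse U1 ** V1)"
    and "r2 \<equiv> spectral_radius (mp_inverse U2 ** V2)"
  assumes types: "(pwr_splitting_I A1 U1 V1 \<and> pwr_splitting_II A2 U2 V2) \<or>
                  (pwr_splitting_II A1 U1 V1 \<and> pwr_splitting_I A2 U2 V2)"
    and "r1 > 0" "r2 > 0" "mat_nonneg (mp_inverse A1)" "mat_nonneg (mp_inverse A2)"
    and Vle: "mat_le V1 V2"
  obtains x y where "vec_nonneg x" "x \<noteq> 0" "vec_nonneg y" "y \<noteq> 0" "r1 < 1" "r2 < 1"
    "r1 * (1 - r2) * (y \<bullet> (mp_inverse A2 *v x)) \<le> r2 * (1 - r1) * (y \<bullet> (mp_inverse A1 *v x))"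
  using types
proof
  assume "pwr_splitting_I A1 U1 V1 \<and> pwr_splitting_II A2 U2 V2"
  then obtain y x where y: "vec_nonneg y" "y \<noteq> 0" "vec_nonneg (y v* mp_inverse U1)"
      "(y v* mp_inverse U1) v* V1 = r1 *\<^sub>R y"
      "y v* mp_inverse U1 = (1 - r1) *\<^sub>R (y v* mp_inverse A1)" "r1 < 1"
    and x: "vec_nonneg x" "x \<noteq> 0" "vec_nonneg (mp_inverse U2 *v x)"
      "V2 *v (mp_inverse U2 *v x) = r2 *\<^sub>R x"
      "mp_inverse U2 *v x = (1 - r2) *\<^sub>R (mp_inverse A2 *v x)" "r2 < 1"
    using pwr_splitting_I_perron_vector pwr_splitting_II_perron_vector assms
    unfolding r1_def r2_def by metis
  have "r1 * (1 - r2) * (y \<bullet> (mp_inverse A2 *v x)) \<le> r2 * (1 - r1) * (y \<bullet> (mp_inverse A1 *v x))"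
    using inner_matrix_vector_mono[OF y(3) x(3) Vle] perron_vectors_pairing[OF y(4,5) x(4,5)]
    by linarith
  then show ?thesis using that x(1,2,6) y(1,2,6) by blast
next
  assume "pwr_splitting_II A1 U1 V1 \<and> pwr_splitting_I A2 U2 V2"
  then obtain y x where y: "vec_nonneg y" "y \<noteq> 0" "vec_nonneg (y v* mp_inverse U2)"
      "(y v* mp_inverse U2) v* V2 = r2 *\<^sub>R y"
      "y v* mp_inverse U2 = (1 - r2) *\<^sub>R (y v* mp_inverse A2)" "r2 < 1"
    and x: "vec_nonneg x" "x \<noteq> 0" "vec_nonneg (mp_inverse U1 *v x)"
      "V1 *v (mp_inverse U1 *v x) = r1 *\<^sub>R x"
      "mp_inverse U1 *v x = (1 - r1) *\<^sub>R (mp_inverse A1 *v x)" "r1 < 1"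
    using pwr_splitting_I_perron_vector pwr_splitting_II_perron_vector assms
    unfolding r1_def r2_def by metis
  have "r1 * (1 - r2) * (y \<bullet> (mp_inverse A2 *v x)) \<le> r2 * (1 - r1) * (y \<bullet> (mp_inverse A1 *v x))"
    using inner_matrix_vector_mono[OF y(3) x(3) Vle] perron_vectors_pairing[OF y(4,5) x(4,5)]
    by linarith
  then show ?thesis using that x(1,2,6) y(1,2,6) by blast
qed

theorem theorem3p14:
  fixes A1 A2 U1 V1 U2 V2 :: "real^'n^'m"
  assumes types: "(pwr_splitting_I A1 U1 V1 \<and> pwr_splitting_II A2 U2 V2) \<or>
                  (pwr_splitting_II A1 U1 V1 \<and> pwr_splitting_I A2 U2 V2)"
    and rho1: "spectral_radius (mp_inverse U1 ** V1) > 0"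
    and rho2: "spectral_radius (mp_inverse U2 ** V2) > 0"
    and V1nz: "V1 \<noteq> 0" and V2nz: "V2 \<noteq> 0"
    and Agt: "mat_gt (mp_inverse A2) (mp_inverse A1)"
    and A1nn: "mat_nonneg (mp_inverse A1)"
    and Vle: "mat_le V1 V2"
  shows "spectral_radius (mp_inverse U1 ** V1) < spectral_radius (mp_inverse U2 ** V2) \<and>
         spectral_radius (mp_inverse U2 ** V2) < 1"
proof -
  let ?r1 = "spectral_radius (mp_inverse U1 ** V1)" and ?r2 = "spectral_radius (mp_inverse U2 ** V2)"
  have A2nn: "mat_nonneg (mp_inverse A2)"
    using Agt A1nn unfolding mat_gt_def mat_nonneg_def by (meson less_imp_le order_trans)
  obtain x y where xy: "vec_nonneg x" "x \<noteq> 0" "vec_nonneg y" "y \<noteq> 0"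
    and r_lt_1: "?r1 < 1" "?r2 < 1"
    and cross: "?r1 * (1 - ?r2) * (y \<bullet> (mp_inverse A2 *v x)) \<le> ?r2 * (1 - ?r1) * (y \<bullet> (mp_inverse A1 *v x))"
    by (rule splittings_of_different_types_cross_inequality[OF types rho1 rho2 A1nn A2nn Vle])
  have "0 \<le> y \<bullet> (mp_inverse A1 *v x)"
    by (rule inner_matrix_vector_nonneg[OF xy(3,1) A1nn])
  moreover have "y \<bullet> (mp_inverse A1 *v x) < y \<bullet> (mp_inverse A2 *v x)"
    by (rule inner_matrix_vector_strict_mono[OF xy(3,4) xy(1,2) Agt])
  ultimately show ?thesis
    using less_of_cross_weighted_le[OF rho1 rho2 r_lt_1 _ _ cross] r_lt_1 by blast
qed

end
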